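(* Suppose that $\varphi\colon\mathsf{S}\to\mathsf{T}$ is a monad morphism between $\mathbf{Ord}$-monads on an $\mathbf{Ord}$-category $\mathcal{C}$ and that its components $\varphi_X\colon SX\to TX$ are $\mathsf{T}$-embeddings. If $\mathsf{T}$ is lax idempotent and the components of its unit $\eta_X\colon X\to TX$ are full, then $\mathsf{S}$ is lax idempotent, with full unit components $e_X\colon X\to SX$.
   Context: $\mathbf{Ord}$ is the category of posets and monotone maps. An $\mathbf{Ord}$-category is a locally small category whose hom-sets are posets and whose composition is monotone in each variable; an $\mathbf{Ord}$-functor is a functor monotone on hom-posets; an $\mathbf{Ord}$-monad is a monad whose functor part is an $\mathbf{Ord}$-functor. An $\mathbf{Ord}$-monad $(T,\eta,\mu)$ is lax idempotent if $T\eta\le\eta T$. A monad morphism $\varphi\colon\mathsf{S}\to\mathsf{T}$ is a natural transformation $S\Rightarrow T$ compatible with units and multiplications. A morphism $g\colon X\to Y$ of $\mathcal{C}$ is full if for all $Z$ and $u,v\colon Z\to X$, $g\cdot u\le g\cdot v$ implies $u\le v$. A morphism $f\colon X\to Y$ is a $\mathsf{T}$-embedding if there is a morphism of free $\mathsf{T}$-algebras $r\colon TY\to TX$ with $r\cdot Tf=1$ and $Tf\cdot r\le1$ (for $\mathsf{T}$ lax idempotent it is equivalent that $Tf$ have such an $r$ in $\mathcal{C}$). *)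

theory Defs
  imports Main
begin

text \<open>
  A category is given by a set of objects and a set of arrows, each arrow having a definite
  domain and codomain. Composition is written in the usual order, so that
  \<open>g \<cdot>\<^bsub>C\<^esub> f\<close> means first \<open>f\<close>, then \<open>g\<close>. The values of \<open>\<cdot>\<^bsub>C\<^esub>\<close> on non-composable arrows
  and of \<open>\<sqsubseteq>\<^bsub>C\<^esub>\<close> on non-parallel arrows are unconstrained.
\<close>

record ('o, 'm) ord_cat =
  Obj :: "'o set"
  Arr :: "'m set"
  Dom :: "'m \<Rightarrow> 'o"
  Cod :: "'m \<Rightarrow> 'o"
  Id :: "'o \<Rightarrow> 'm"
  Comp :: "'m \<Rightarrow> 'm \<Rightarrow> 'm" (infixl "\<cdot>\<index>" 70)
  Leq :: "'m \<Rightarrow> 'm \<Rightarrow> bool" (infix "\<sqsubseteq>\<index>" 50)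

definition Hom :: "('o, 'm, 'x) ord_cat_scheme \<Rightarrow> 'o \<Rightarrow> 'o \<Rightarrow> 'm set" where
  "Hom C X Y = {f \<in> Arr C. Dom C f = X \<and> Cod C f = Y}"

locale ord_category =
  fixes C :: "('o, 'm, 'x) ord_cat_scheme" (structure)
  assumes Dom_Obj: "f \<in> Arr C \<Longrightarrow> Dom C f \<in> Obj C"
    and Cod_Obj: "f \<in> Arr C \<Longrightarrow> Cod C f \<in> Obj C"
    and Id_Hom: "X \<in> Obj C \<Longrightarrow> Id C X \<in> Hom C X X"
    and Comp_Hom: "\<lbrakk>f \<in> Hom C X Y; g \<in> Hom C Y Z\<rbrakk> \<Longrightarrow> g \<cdot> f \<in> Hom C X Z"
    and Comp_Id: "f \<in> Hom C X Y \<Longrightarrow> f \<cdot> Id C X = f"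
    and Id_Comp: "f \<in> Hom C X Y \<Longrightarrow> Id C Y \<cdot> f = f"
    and Comp_assoc:
      "\<lbrakk>f \<in> Hom C W X; g \<in> Hom C X Y; h \<in> Hom C Y Z\<rbrakk> \<Longrightarrow> (h \<cdot> g) \<cdot> f = h \<cdot> (g \<cdot> f)"
    and Leq_refl: "f \<in> Hom C X Y \<Longrightarrow> f \<sqsubseteq> f"
    and Leq_trans:
      "\<lbrakk>f \<in> Hom C X Y; g \<in> Hom C X Y; h \<in> Hom C X Y; f \<sqsubseteq> g; g \<sqsubseteq> h\<rbrakk> \<Longrightarrow> f \<sqsubseteq> h"
    and Leq_antisym:
      "\<lbrakk>f \<in> Hom C X Y; g \<in> Hom C X Y; f \<sqsubseteq> g; g \<sqsubseteq> f\<rbrakk> \<Longrightarrow> f = g"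
    and Comp_mono_left:
      "\<lbrakk>f \<in> Hom C X Y; g \<in> Hom C Y Z; g' \<in> Hom C Y Z; g \<sqsubseteq> g'\<rbrakk> \<Longrightarrow> g \<cdot> f \<sqsubseteq> g' \<cdot> f"
    and Comp_mono_right:
      "\<lbrakk>f \<in> Hom C X Y; f' \<in> Hom C X Y; g \<in> Hom C Y Z; f \<sqsubseteq> f'\<rbrakk> \<Longrightarrow> g \<cdot> f \<sqsubseteq> g \<cdot> f'"

definition full :: "('o, 'm, 'x) ord_cat_scheme \<Rightarrow> 'm \<Rightarrow> bool" where
  "full C g \<longleftrightarrow> g \<in> Arr C \<and>
    (\<forall>Z\<in>Obj C. \<forall>u\<in>Hom C Z (Dom C g). \<forall>v\<in>Hom C Z (Dom C g).
      g \<cdot>\<^bsub>C\<^esub> u \<sqsubseteq>\<^bsub>C\<^esub> g \<cdot>\<^bsub>C\<^esub> v \<longrightarrow> u \<sqsubseteq>\<^bsub>C\<^esub> v)"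

record ('o, 'm) endo =
  omap :: "'o \<Rightarrow> 'o"
  amap :: "'m \<Rightarrow> 'm"

definition id_endo :: "('o, 'm) endo" where
  "id_endo = \<lparr>omap = (\<lambda>X. X), amap = (\<lambda>f. f)\<rparr>"

definition comp_endo ::
  "('o, 'm, 'y) endo_scheme \<Rightarrow> ('o, 'm, 'z) endo_scheme \<Rightarrow> ('o, 'm) endo" where
  "comp_endo F G = \<lparr>omap = (\<lambda>X. omap F (omap G X)), amap = (\<lambda>f. amap F (amap G f))\<rparr>"

definition ord_endofunctor ::
  "('o, 'm, 'x) ord_cat_scheme \<Rightarrow> ('o, 'm, 'y) endo_scheme \<Rightarrow> bool" where
  "ord_endofunctor C F \<longleftrightarrow>
    (\<forall>X\<in>Obj C. omap F X \<in> Obj C) \<and>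
    (\<forall>X\<in>Obj C. \<forall>Y\<in>Obj C. \<forall>f\<in>Hom C X Y. amap F f \<in> Hom C (omap F X) (omap F Y)) \<and>
    (\<forall>X\<in>Obj C. amap F (Id C X) = Id C (omap F X)) \<and>
    (\<forall>X\<in>Obj C. \<forall>Y\<in>Obj C. \<forall>Z\<in>Obj C. \<forall>f\<in>Hom C X Y. \<forall>g\<in>Hom C Y Z.
      amap F (g \<cdot>\<^bsub>C\<^esub> f) = amap F g \<cdot>\<^bsub>C\<^esub> amap F f) \<and>
    (\<forall>X\<in>Obj C. \<forall>Y\<in>Obj C. \<forall>f\<in>Hom C X Y. \<forall>g\<in>Hom C X Y.
      f \<sqsubseteq>\<^bsub>C\<^esub> g \<longrightarrow> amap F f \<sqsubseteq>\<^bsub>C\<^esub> amap F g)"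

definition nat_trans ::
  "('o, 'm, 'x) ord_cat_scheme \<Rightarrow> ('o, 'm, 'y) endo_scheme \<Rightarrow> ('o, 'm, 'z) endo_scheme
    \<Rightarrow> ('o \<Rightarrow> 'm) \<Rightarrow> bool" where
  "nat_trans C F G \<tau> \<longleftrightarrow>
    (\<forall>X\<in>Obj C. \<tau> X \<in> Hom C (omap F X) (omap G X)) \<and>
    (\<forall>X\<in>Obj C. \<forall>Y\<in>Obj C. \<forall>f\<in>Hom C X Y. \<tau> Y \<cdot>\<^bsub>C\<^esub> amap F f = amap G f \<cdot>\<^bsub>C\<^esub> \<tau> X)"

record ('o, 'm) endo_monad = "('o, 'm) endo" +
  unit :: "'o \<Rightarrow> 'm"
  mult :: "'o \<Rightarrow> 'm"

definition ord_monad ::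
  "('o, 'm, 'x) ord_cat_scheme \<Rightarrow> ('o, 'm, 'y) endo_monad_scheme \<Rightarrow> bool" where
  "ord_monad C T \<longleftrightarrow>
    ord_endofunctor C T \<and>
    nat_trans C id_endo T (unit T) \<and>
    nat_trans C (comp_endo T T) T (mult T) \<and>
    (\<forall>X\<in>Obj C. mult T X \<cdot>\<^bsub>C\<^esub> unit T (omap T X) = Id C (omap T X)) \<and>
    (\<forall>X\<in>Obj C. mult T X \<cdot>\<^bsub>C\<^esub> amap T (unit T X) = Id C (omap T X)) \<and>
    (\<forall>X\<in>Obj C. mult T X \<cdot>\<^bsub>C\<^esub> mult T (omap T X) = mult T X \<cdot>\<^bsub>C\<^esub> amap T (mult T X))"

definition lax_idempotent ::
  "('o, 'm, 'x) ord_cat_scheme \<Rightarrow> ('o, 'm, 'y) endo_monad_scheme \<Rightarrow> bool" where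
  "lax_idempotent C T \<longleftrightarrow>
    ord_monad C T \<and> (\<forall>X\<in>Obj C. amap T (unit T X) \<sqsubseteq>\<^bsub>C\<^esub> unit T (omap T X))"

text \<open>
  Compatibility with multiplication reads \<open>\<phi> \<cdot> \<mu>\<^sup>S = \<mu>\<^sup>T \<cdot> (\<phi> * \<phi>)\<close>, where the component at \<open>X\<close> of the
  horizontal composite \<open>\<phi> * \<phi>\<close> is \<open>\<phi>\<^bsub>TX\<^esub> \<cdot> S\<phi>\<^bsub>X\<^esub>\<close>, equal by naturality to \<open>T\<phi>\<^bsub>X\<^esub> \<cdot> \<phi>\<^bsub>SX\<^esub>\<close>.
\<close>

definition monad_morphism ::
  "('o, 'm, 'x) ord_cat_scheme \<Rightarrow> ('o, 'm, 'y) endo_monad_scheme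
    \<Rightarrow> ('o, 'm, 'z) endo_monad_scheme \<Rightarrow> ('o \<Rightarrow> 'm) \<Rightarrow> bool" where
  "monad_morphism C S T \<phi> \<longleftrightarrow>
    nat_trans C S T \<phi> \<and>
    (\<forall>X\<in>Obj C. \<phi> X \<cdot>\<^bsub>C\<^esub> unit S X = unit T X) \<and>
    (\<forall>X\<in>Obj C. \<phi> X \<cdot>\<^bsub>C\<^esub> mult S X
      = mult T X \<cdot>\<^bsub>C\<^esub> (\<phi> (omap T X) \<cdot>\<^bsub>C\<^esub> amap S (\<phi> X)))"

definition em_algebra ::
  "('o, 'm, 'x) ord_cat_scheme \<Rightarrow> ('o, 'm, 'y) endo_monad_scheme \<Rightarrow> 'o \<times> 'm \<Rightarrow> bool" where
  "em_algebra C T = (\<lambda>(A, a).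
    A \<in> Obj C \<and> a \<in> Hom C (omap T A) A \<and>
    a \<cdot>\<^bsub>C\<^esub> unit T A = Id C A \<and> a \<cdot>\<^bsub>C\<^esub> mult T A = a \<cdot>\<^bsub>C\<^esub> amap T a)"

definition algebra_morphism ::
  "('o, 'm, 'x) ord_cat_scheme \<Rightarrow> ('o, 'm, 'y) endo_monad_scheme
    \<Rightarrow> 'o \<times> 'm \<Rightarrow> 'o \<times> 'm \<Rightarrow> 'm \<Rightarrow> bool" where
  "algebra_morphism C T = (\<lambda>(A, a) (B, b) h.
    em_algebra C T (A, a) \<and> em_algebra C T (B, b) \<and>
    h \<in> Hom C A B \<and> h \<cdot>\<^bsub>C\<^esub> a = b \<cdot>\<^bsub>C\<^esub> amap T h)"

definition free_algebra :: "('o, 'm, 'y) endo_monad_scheme \<Rightarrow> 'o \<Rightarrow> 'o \<times> 'm" where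
  "free_algebra T X = (omap T X, mult T X)"

definition embedding ::
  "('o, 'm, 'x) ord_cat_scheme \<Rightarrow> ('o, 'm, 'y) endo_monad_scheme \<Rightarrow> 'm \<Rightarrow> bool" where
  "embedding C T f \<longleftrightarrow> f \<in> Arr C \<and>
    (\<exists>r. algebra_morphism C T (free_algebra T (Cod C f)) (free_algebra T (Dom C f)) r \<and>
      r \<cdot>\<^bsub>C\<^esub> amap T f = Id C (omap T (Dom C f)) \<and>
      amap T f \<cdot>\<^bsub>C\<^esub> r \<sqsubseteq>\<^bsub>C\<^esub> Id C (omap T (Cod C f)))"

end

theory Submission
  imports Defs
begin

text \<open>
  Full arrows compose, and if \<open>g \<cdot> f\<close> is full, so is \<open>f\<close>. As \<open>\<eta> = \<phi> \<cdot> e\<close> is full, \<open>e\<close> is full.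
  For a \<open>T\<close>-embedding \<open>f\<close> the arrow \<open>Tf\<close> is a split monomorphism, hence full; so
  \<open>\<eta> \<cdot> f = Tf \<cdot> \<eta>\<close> is full, and with it \<open>f\<close>. In particular \<open>\<phi>\<close> and \<open>T\<phi>\<close> are full. Now
  \<open>\<phi>\<^sub>S \<cdot> Se = Te \<cdot> \<phi>\<close> and \<open>\<phi>\<^sub>S \<cdot> eS = \<eta>\<^sub>S\<close>, and applying \<open>T\<phi>\<close> gives
  \<open>T\<phi> \<cdot> Te \<cdot> \<phi> = T\<eta> \<cdot> \<phi> \<sqsubseteq> \<eta>\<^sub>T \<cdot> \<phi> = T\<phi> \<cdot> \<eta>\<^sub>S\<close>. Cancelling first \<open>T\<phi>\<close> and then \<open>\<phi>\<^sub>S\<close> yields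
  \<open>Se \<sqsubseteq> eS\<close>.
\<close>

lemma Hom_Arr: "f \<in> Hom C X Y \<Longrightarrow> f \<in> Arr C \<and> Dom C f = X \<and> Cod C f = Y"
  by (simp add: Hom_def)

text \<open>\<open>full\<close> speaks of arrows into \<open>Dom C g\<close>. This rule and
  \<open>fullI\<close> recast it for a \<open>g\<close> of known hom-set, so that each later
  cancellation is a resolution with typing facts.\<close>

lemma fullD:
  assumes "full C g" "g \<in> Hom C X Y" "Z \<in> Obj C" "u \<in> Hom C Z X" "v \<in> Hom C Z X"
    and "g \<cdot>\<^bsub>C\<^esub> u \<sqsubseteq>\<^bsub>C\<^esub> g \<cdot>\<^bsub>C\<^esub> v"
  shows "u \<sqsubseteq>\<^bsub>C\<^esub> v"
  using assms unfolding full_def by (auto dest: Hom_Arr)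

lemma fullI:
  assumes "g \<in> Hom C X Y"
    and "\<And>Z u v. \<lbrakk>Z \<in> Obj C; u \<in> Hom C Z X; v \<in> Hom C Z X; g \<cdot>\<^bsub>C\<^esub> u \<sqsubseteq>\<^bsub>C\<^esub> g \<cdot>\<^bsub>C\<^esub> v\<rbrakk>
      \<Longrightarrow> u \<sqsubseteq>\<^bsub>C\<^esub> v"
  shows "full C g"
  using assms unfolding full_def by (auto dest: Hom_Arr)

context ord_category
begin

lemma full_comp:
  assumes f: "f \<in> Hom C X Y" "full C f" and g: "g \<in> Hom C Y Z" "full C g"
  shows "full C (g \<cdot> f)"
proof (rule fullI)
  show "g \<cdot> f \<in> Hom C X Z"
    using f(1) g(1) by (rule Comp_Hom)
next
  fix W u v
  assume W: "W \<in> Obj C" and u: "u \<in> Hom C W X" and v: "v \<in> Hom C W X"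
    and le: "(g \<cdot> f) \<cdot> u \<sqsubseteq> (g \<cdot> f) \<cdot> v"
  have "g \<cdot> (f \<cdot> u) \<sqsubseteq> g \<cdot> (f \<cdot> v)"
    using le by (simp add: Comp_assoc[OF u f(1) g(1)] Comp_assoc[OF v f(1) g(1)])
  then have "f \<cdot> u \<sqsubseteq> f \<cdot> v"
    by (rule fullD[OF g(2,1) W Comp_Hom[OF u f(1)] Comp_Hom[OF v f(1)]])
  then show "u \<sqsubseteq> v"
    by (rule fullD[OF f(2,1) W u v])
qed

text \<open>Postcomposition with \<open>g\<close> is monotone, so
  \<open>f \<cdot> u \<sqsubseteq> f \<cdot> v\<close> passes to \<open>g \<cdot> f\<close>, where
  it can be cancelled.\<close>

lemma full_cancel:
  assumes f: "f \<in> Hom C X Y" and g: "g \<in> Hom C Y Z" and gf: "full C (g \<cdot> f)"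
  shows "full C f"
proof (rule fullI[OF f])
  fix W u v
  assume W: "W \<in> Obj C" and u: "u \<in> Hom C W X" and v: "v \<in> Hom C W X"
    and le: "f \<cdot> u \<sqsubseteq> f \<cdot> v"
  have "g \<cdot> (f \<cdot> u) \<sqsubseteq> g \<cdot> (f \<cdot> v)"
    by (rule Comp_mono_right[OF Comp_Hom[OF u f] Comp_Hom[OF v f] g le])
  then have "(g \<cdot> f) \<cdot> u \<sqsubseteq> (g \<cdot> f) \<cdot> v"
    by (simp add: Comp_assoc[OF u f g] Comp_assoc[OF v f g])
  then show "u \<sqsubseteq> v"
    by (rule fullD[OF gf Comp_Hom[OF f g] W u v])
qed

lemma full_Id:
  assumes "X \<in> Obj C"
  shows "full C (Id C X)"
  by (rule fullI[OF Id_Hom[OF assms]]) (simp add: Id_Comp)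

text \<open>The left inverse \<open>r\<close> supplied by the embedding makes
  \<open>r \<cdot> amap T f\<close> an identity, which is full; \<open>full_cancel\<close> then
  strips off \<open>r\<close>.\<close>

lemma embedding_full_amap:
  assumes T: "ord_endofunctor C T" and X: "X \<in> Obj C" and Y: "Y \<in> Obj C"
    and f: "f \<in> Hom C X Y" and emb: "embedding C T f"
  shows "full C (amap T f)"
proof -
  obtain r where r: "r \<in> Hom C (omap T Y) (omap T X)" "r \<cdot> amap T f = Id C (omap T X)"
    using emb Hom_Arr[OF f]
    unfolding embedding_def algebra_morphism_def free_algebra_def by auto
  have Tf: "amap T f \<in> Hom C (omap T X) (omap T Y)" and TX: "omap T X \<in> Obj C"
    using T X Y f unfolding ord_endofunctor_def by blast+
  show ?thesis
    by (rule full_cancel[OF Tf r(1)]) (simp add: r(2) full_Id[OF TX])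
qed

lemma embedding_full:
  assumes T: "ord_endofunctor C T" and unit: "nat_trans C id_endo T \<eta>"
    and X: "X \<in> Obj C" and Y: "Y \<in> Obj C" and f: "f \<in> Hom C X Y"
    and emb: "embedding C T f" and full: "full C (\<eta> X)"
  shows "full C f"
proof -
  have Tf: "amap T f \<in> Hom C (omap T X) (omap T Y)"
    using T X Y f unfolding ord_endofunctor_def by blast
  have \<eta>: "\<eta> X \<in> Hom C X (omap T X)" "\<eta> Y \<in> Hom C Y (omap T Y)"
    and nat: "\<eta> Y \<cdot> f = amap T f \<cdot> \<eta> X"
    using unit X Y f unfolding nat_trans_def id_endo_def by auto
  \<comment> \<open>Naturality at \<open>f\<close> replaces this composite by one of two full
    arrows.\<close>
  have "full C (\<eta> Y \<cdot> f)"
    unfolding nat by (rule full_comp[OF \<eta>(1) full Tf embedding_full_amap[OF T X Y f emb]])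
  then show ?thesis
    by (rule full_cancel[OF f \<eta>(2)])
qed

end

theorem proposition12p2:
  fixes C :: "('o, 'm) ord_cat"
    and S T :: "('o, 'm) endo_monad"
    and \<phi> :: "'o \<Rightarrow> 'm"
  assumes "ord_category C"
    and "ord_monad C S"
    and "ord_monad C T"
    and "monad_morphism C S T \<phi>"
    and "\<forall>X\<in>Obj C. embedding C T (\<phi> X)"
    and "lax_idempotent C T"
    and "\<forall>X\<in>Obj C. full C (unit T X)"
  shows "lax_idempotent C S \<and> (\<forall>X\<in>Obj C. full C (unit S X))"
proof -
  interpret ord_category C by fact
  have FS: "ord_endofunctor C S" and nS: "nat_trans C id_endo S (unit S)"
    using \<open>ord_monad C S\<close> by (auto simp: ord_monad_def)
  have FT: "ord_endofunctor C T" and nT: "nat_trans C id_endo T (unit T)"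
    using \<open>ord_monad C T\<close> by (auto simp: ord_monad_def)
  have n\<phi>: "nat_trans C S T \<phi>" and \<phi>e: "\<And>X. X \<in> Obj C \<Longrightarrow> \<phi> X \<cdot>\<^bsub>C\<^esub> unit S X = unit T X"
    using \<open>monad_morphism C S T \<phi>\<close> by (auto simp: monad_morphism_def)
  have e: "unit S X \<in> Hom C X (omap S X)" if "X \<in> Obj C" for X
    using nS that by (auto simp: nat_trans_def id_endo_def)
  have \<eta>: "unit T X \<in> Hom C X (omap T X)" if "X \<in> Obj C" for X
    using nT that by (auto simp: nat_trans_def id_endo_def)
  have \<phi>: "\<phi> X \<in> Hom C (omap S X) (omap T X)" if "X \<in> Obj C" for X
    using n\<phi> that by (auto simp: nat_trans_def)
  have full_e: "full C (unit S X)" if X: "X \<in> Obj C" for X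
    using full_cancel[OF e[OF X] \<phi>[OF X]] \<phi>e[OF X] assms(7) X by simp
  have "amap S (unit S X) \<sqsubseteq>\<^bsub>C\<^esub> unit S (omap S X)" if X: "X \<in> Obj C" for X
  proof -
    have SX: "omap S X \<in> Obj C" and TX: "omap T X \<in> Obj C"
      using FS FT X by (auto simp: ord_endofunctor_def)
    have SSX: "omap S (omap S X) \<in> Obj C" and TSX: "omap T (omap S X) \<in> Obj C"
      using FS FT SX by (auto simp: ord_endofunctor_def)
    have Se: "amap S (unit S X) \<in> Hom C (omap S X) (omap S (omap S X))"
      using FS X SX e[OF X] unfolding ord_endofunctor_def by blast
    have Te: "amap T (unit S X) \<in> Hom C (omap T X) (omap T (omap S X))"
      and T\<phi>: "amap T (\<phi> X) \<in> Hom C (omap T (omap S X)) (omap T (omap T X))"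
      and T\<eta>: "amap T (unit T X) \<in> Hom C (omap T X) (omap T (omap T X))"
      using FT X SX TX e[OF X] \<phi>[OF X] \<eta>[OF X] unfolding ord_endofunctor_def by blast+
    have full_T\<phi>: "full C (amap T (\<phi> X))"
      using embedding_full_amap[OF FT SX TX \<phi>[OF X]] assms(5) X by blast
    \<comment> \<open>The domain of this component is \<open>omap S (omap S X)\<close>, so fullness
      of the unit of \<open>T\<close> is invoked at that object.\<close>
    have full_\<phi>: "full C (\<phi> (omap S X))"
      using embedding_full[OF FT nT SSX TSX \<phi>[OF SX]] assms(5,7) SX SSX by blast
    have "amap T (\<phi> X) \<cdot>\<^bsub>C\<^esub> (amap T (unit S X) \<cdot>\<^bsub>C\<^esub> \<phi> X)
        = (amap T (\<phi> X) \<cdot>\<^bsub>C\<^esub> amap T (unit S X)) \<cdot>\<^bsub>C\<^esub> \<phi> X"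
      by (rule Comp_assoc[OF \<phi>[OF X] Te T\<phi>, symmetric])
    also have "amap T (\<phi> X) \<cdot>\<^bsub>C\<^esub> amap T (unit S X) = amap T (\<phi> X \<cdot>\<^bsub>C\<^esub> unit S X)"
      using FT X SX TX e[OF X] \<phi>[OF X] unfolding ord_endofunctor_def by metis
    also have "\<dots> = amap T (unit T X)"
      by (simp add: \<phi>e[OF X])
    finally have left: "amap T (\<phi> X) \<cdot>\<^bsub>C\<^esub> (amap T (unit S X) \<cdot>\<^bsub>C\<^esub> \<phi> X)
        = amap T (unit T X) \<cdot>\<^bsub>C\<^esub> \<phi> X" .
    \<comment> \<open>Naturality of the unit of \<open>T\<close> at the arrow
      \<open>\<phi> X\<close>.\<close>
    have right: "amap T (\<phi> X) \<cdot>\<^bsub>C\<^esub> unit T (omap S X) = unit T (omap T X) \<cdot>\<^bsub>C\<^esub> \<phi> X"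
      using nT SX TX \<phi>[OF X] by (simp add: nat_trans_def id_endo_def)
    have "amap T (unit T X) \<sqsubseteq>\<^bsub>C\<^esub> unit T (omap T X)"
      using \<open>lax_idempotent C T\<close> X by (simp add: lax_idempotent_def)
    then have "amap T (unit T X) \<cdot>\<^bsub>C\<^esub> \<phi> X \<sqsubseteq>\<^bsub>C\<^esub> unit T (omap T X) \<cdot>\<^bsub>C\<^esub> \<phi> X"
      by (rule Comp_mono_left[OF \<phi>[OF X] T\<eta> \<eta>[OF TX]])
    \<comment> \<open>By \<open>left\<close> and \<open>right\<close> both sides carry the factor
      \<open>amap T (\<phi> X)\<close> in front, and fullness removes it.\<close>
    then have "amap T (unit S X) \<cdot>\<^bsub>C\<^esub> \<phi> X \<sqsubseteq>\<^bsub>C\<^esub> unit T (omap S X)"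
      unfolding left[symmetric] right[symmetric]
      by (rule fullD[OF full_T\<phi> T\<phi> SX Comp_Hom[OF \<phi>[OF X] Te] \<eta>[OF SX]])
    \<comment> \<open>Naturality of \<open>\<phi>\<close> at \<open>unit S X\<close> brings out the
      factor \<open>\<phi> (omap S X)\<close> on the left; on the right it comes from the
      compatibility of \<open>\<phi>\<close> with units at \<open>omap S X\<close>.\<close>
    moreover have "\<phi> (omap S X) \<cdot>\<^bsub>C\<^esub> amap S (unit S X) = amap T (unit S X) \<cdot>\<^bsub>C\<^esub> \<phi> X"
      using n\<phi> X SX e[OF X] by (simp add: nat_trans_def)
    ultimately have "\<phi> (omap S X) \<cdot>\<^bsub>C\<^esub> amap S (unit S X) \<sqsubseteq>\<^bsub>C\<^esub> \<phi> (omap S X) \<cdot>\<^bsub>C\<^esub> unit S (omap S X)"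
      by (simp add: \<phi>e[OF SX])
    then show ?thesis
      by (rule fullD[OF full_\<phi> \<phi>[OF SX] SX Se e[OF SX]])
  qed
  with \<open>ord_monad C S\<close> full_e show ?thesis
    by (simp add: lax_idempotent_def)
qed

end
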